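(* Let $1\le k\le M$ and $x>0$. Let $i^*$ be the index of the device with the $k$-th largest uplink channel gain among $|h_1|^2,\dots,|h_M|^2$ (information-based selection, IBS) and $\Pi^{(k)}_{\rm IBS}(x)=\mathbb P\{X_{i^*}\le x\}$. With all other parameters fixed, $$\Pi^\infty_{\rm IBS}(x):=\lim_{P_t\to\infty}\Pi^{(k)}_{\rm IBS}(x)=1-k\binom Mk\sum_{m=0}^{M-k}(-1)^m\binom{M-k}{m}\frac1{k+m}\exp\left(-\frac{\sigma_n^2ct_2x}{t_1(ac-b)}(k+m)\right).$$
   Context: There are $M\ge 1$ devices. The channel gains $|g_1|^2,\dots,|g_M|^2,|h_1|^2,\dots,|h_M|^2$ are independent exponential random variables with mean $1$. Parameters: $P_t>0$, $\sigma_n^2>0$, $0<t_1<1$, $t_2=1-t_1$, and real constants $a,b,c$ with $c>0$ and $ac-b>0$. The energy harvested by device $i$ is $E_i=t_1\left(\frac{aP_t|g_i|^2+b}{P_t|g_i|^2+c}-\frac bc\right)$, and the SNR of device $i$ is $X_i=\frac{|h_i|^2}{t_2\sigma_n^2}E_i$. *)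

theory Defs
  imports "HOL-Probability.Probability"
begin

definition harvested_energy ::
    "real \<Rightarrow> real \<Rightarrow> real \<Rightarrow> real \<Rightarrow> real \<Rightarrow> complex \<Rightarrow> real" where
  "harvested_energy a b c t\<^sub>1 P\<^sub>t g =
     t\<^sub>1 * ((a * P\<^sub>t * (cmod g)\<^sup>2 + b) / (P\<^sub>t * (cmod g)\<^sup>2 + c) - b / c)"

text \<open>The argument \<open>noise\<close> is the noise variance \<open>\<sigma>\<^sub>n\<^sup>2\<close>, not its square root.\<close>
definition snr ::
    "real \<Rightarrow> real \<Rightarrow> real \<Rightarrow> real \<Rightarrow> real \<Rightarrow> real \<Rightarrow> real \<Rightarrow> complex \<Rightarrow> complex \<Rightarrow> real" where
  "snr a b c t\<^sub>1 t\<^sub>2 noise P\<^sub>t g h =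
     (cmod h)\<^sup>2 / (t\<^sub>2 * noise) * harvested_energy a b c t\<^sub>1 P\<^sub>t g"

text \<open>With ties several indices may qualify for the same \<open>k\<close>, one for each admissible
  descending arrangement of the values.\<close>
definition is_kth_largest :: "nat \<Rightarrow> nat \<Rightarrow> (nat \<Rightarrow> real) \<Rightarrow> nat \<Rightarrow> bool" where
  "is_kth_largest M k v i \<longleftrightarrow>
     (\<exists>\<pi>. bij_betw \<pi> {1..M} {1..M} \<and>
          (\<forall>j\<in>{1..M}. \<forall>l\<in>{1..M}. j \<le> l \<longrightarrow> v (\<pi> l) \<le> v (\<pi> j)) \<and>
          \<pi> k = i)"

text \<open>Information-based selection: a random index that always points to a device with the
  \<open>k\<close>-th largest uplink gain.  Ties, which have probability 0 for continuous gains, may be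
  broken in any measurable way; without measurability the event \<open>X\<^sub>i\<^sub>* \<le> x\<close> need not have a
  probability.\<close>
definition ibs_selection ::
    "'w measure \<Rightarrow> nat \<Rightarrow> nat \<Rightarrow> (nat \<Rightarrow> 'w \<Rightarrow> complex) \<Rightarrow> ('w \<Rightarrow> nat) \<Rightarrow> bool" where
  "ibs_selection \<Omega> M k h sel \<longleftrightarrow>
     sel \<in> measurable \<Omega> (count_space UNIV) \<and>
     (\<forall>\<omega>\<in>space \<Omega>. is_kth_largest M k (\<lambda>i. (cmod (h i \<omega>))\<^sup>2) (sel \<omega>))"

text \<open>The joint family of all \<open>2M\<close> gains is indexed by a disjoint sum (left: \<open>g\<close>, right: \<open>h\<close>);
  \<open>exponential_density\<close> takes the rate, which is the reciprocal of the mean.\<close>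
definition iid_exponential_gains ::
    "'w measure \<Rightarrow> nat \<Rightarrow> (nat \<Rightarrow> 'w \<Rightarrow> complex) \<Rightarrow> (nat \<Rightarrow> 'w \<Rightarrow> complex) \<Rightarrow> bool" where
  "iid_exponential_gains \<Omega> M g h \<longleftrightarrow>
     prob_space.indep_vars \<Omega> (\<lambda>_. borel)
       (\<lambda>s \<omega>. case s of Inl i \<Rightarrow> (cmod (g i \<omega>))\<^sup>2 | Inr i \<Rightarrow> (cmod (h i \<omega>))\<^sup>2)
       ({1..M} <+> {1..M}) \<and>
     (\<forall>i\<in>{1..M}. distributed \<Omega> lborel (\<lambda>\<omega>. (cmod (g i \<omega>))\<^sup>2) (exponential_density 1)) \<and>
     (\<forall>i\<in>{1..M}. distributed \<Omega> lborel (\<lambda>\<omega>. (cmod (h i \<omega>))\<^sup>2) (exponential_density 1))"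

definition outage_prob ::
    "'w measure \<Rightarrow> real \<Rightarrow> real \<Rightarrow> real \<Rightarrow> real \<Rightarrow> real \<Rightarrow> real \<Rightarrow>
     (nat \<Rightarrow> 'w \<Rightarrow> complex) \<Rightarrow> (nat \<Rightarrow> 'w \<Rightarrow> complex) \<Rightarrow> ('w \<Rightarrow> nat) \<Rightarrow> real \<Rightarrow> real \<Rightarrow> real" where
  "outage_prob \<Omega> a b c t\<^sub>1 t\<^sub>2 noise g h sel x P\<^sub>t =
     measure \<Omega> {\<omega> \<in> space \<Omega>.
       snr a b c t\<^sub>1 t\<^sub>2 noise P\<^sub>t (g (sel \<omega>) \<omega>) (h (sel \<omega>) \<omega>) \<le> x}"

end

(* As P_t grows, the harvested energy increases to t_1 (ac - b) / c whenever the downlink gain is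
   nonzero, so the SNR of the selected device converges almost surely, strictly from below, to a
   multiple of its uplink gain.  Hence the events {X <= x} converge almost surely (also on the
   boundary of the limit event), and dominated convergence gives the limit of their
   probabilities.  The k-th largest gain exceeds a threshold iff at least k gains do, which is a
   binomial tail; its alternating-sum form follows by comparing derivatives in the success
   probability. *)

theory Submission
  imports Defs
begin

text \<open>Two polynomials in \<open>p\<close> that vanish at 0 and have the same derivative
  coincide. The common derivative is the Beta density with parameters \<open>k\<close> and
  \<open>n - k + 1\<close>: on the left it is what survives a telescoping sum, on the right it
  appears once the binomial theorem is read backwards.\<close>

lemma binomial_tail_eq_alternating_sum:
  fixes p :: real
  assumes "1 \<le> k" "k \<le> n"
  shows "(\<Sum>j=k..n. real (n choose j) * p ^ j * (1 - p) ^ (n - j)) =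
    real k * real (n choose k) *
      (\<Sum>m=0..n - k. (-1) ^ m * real ((n - k) choose m) * (1 / real (k + m)) * p ^ (k + m))"
proof -
  define L where "L p = (\<Sum>j=k..n. real (n choose j) * p ^ j * (1 - p) ^ (n - j))" for p :: real
  define R where "R p = real k * real (n choose k) *
      (\<Sum>m=0..n - k. (-1) ^ m * real ((n - k) choose m) * (1 / real (k + m)) * p ^ (k + m))"
    for p :: real
  \<comment> \<open>\<open>T p j\<close> is what comes from differentiating the factor
    \<open>p ^ j\<close> in the \<open>j\<close>-th term of \<open>L\<close>. The other factor
    contributes \<open>- T p (Suc j)\<close>, so consecutive terms cancel.\<close>
  define T where "T p j = real j * real (n choose j) * p ^ (j - 1) * (1 - p) ^ (n - j)"
    for p :: real and j
  have dL: "(L has_field_derivative T p k) (at p)" for p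
  proof -
    have dterm: "((\<lambda>p. real (n choose j) * p ^ j * (1 - p) ^ (n - j)) has_field_derivative
        - (T p (Suc j) - T p j)) (at p)" if "j \<le> n" for j
    proof -
      have "real (Suc j) * real (n choose Suc j) = real (n - j) * real (n choose j)"
        by (metis binomial_absorption binomial_absorb_comp of_nat_mult)
      hence "T p (Suc j) = real (n - j) * real (n choose j) * p ^ j * (1 - p) ^ (n - j - 1)"
        unfolding T_def by simp
      thus ?thesis
        by (auto intro!: derivative_eq_intros simp: T_def algebra_simps)
    qed
    have "(L has_field_derivative (\<Sum>j=k..n. - (T p (Suc j) - T p j))) (at p)"
      unfolding L_def by (intro DERIV_sum dterm) auto
    moreover have "(\<Sum>j=k..n. - (T p (Suc j) - T p j)) = T p k - T p (Suc n)"
      using sum_Suc_diff[of k n "T p"] assms by (simp only: sum_negf)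
    \<comment> \<open>The upper end of the telescope vanishes because \<open>n choose Suc n\<close>
      is 0.\<close>
    moreover have "T p (Suc n) = 0" by (simp add: T_def binomial_eq_0)
    ultimately show ?thesis by simp
  qed
  have dR: "(R has_field_derivative T p k) (at p)" for p
  proof -
    have "(R has_field_derivative real k * real (n choose k) *
        (\<Sum>m=0..n - k. (-1) ^ m * real ((n - k) choose m) * p ^ (k + m - 1))) (at p)"
      unfolding R_def
    proof (intro DERIV_cmult DERIV_sum)
      fix m
      show "((\<lambda>p. (-1) ^ m * real ((n - k) choose m) * (1 / real (k + m)) * p ^ (k + m))
        has_field_derivative (-1) ^ m * real ((n - k) choose m) * p ^ (k + m - 1)) (at p)"
        using assms by (auto intro!: derivative_eq_intros simp del: of_nat_add)
    qed
    \<comment> \<open>Differentiation has cancelled \<open>1 / real (k + m)\<close>. With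
      \<open>p ^ (k - 1)\<close> pulled out, the rest is the expansion of
      \<open>(- p + 1) ^ (n - k)\<close>; the powers of 1 only match the shape of
      \<open>binomial_ring\<close>.\<close>
    also have "(\<Sum>m=0..n - k. (-1) ^ m * real ((n - k) choose m) * p ^ (k + m - 1)) =
        p ^ (k - 1) * (\<Sum>m\<le>n - k. real ((n - k) choose m) * (- p) ^ m * 1 ^ (n - k - m))"
      unfolding sum_distrib_left atMost_atLeast0
    proof (rule sum.cong[OF refl])
      fix m
      have "k + m - 1 = (k - 1) + m" using assms by simp
      thus "(-1) ^ m * real ((n - k) choose m) * p ^ (k + m - 1) =
          p ^ (k - 1) * (real ((n - k) choose m) * (- p) ^ m * 1 ^ (n - k - m))"
        by (simp add: power_add power_minus[of p])
    qed
    also have "\<dots> = p ^ (k - 1) * (1 - p) ^ (n - k)"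
      using binomial_ring[of "- p" 1 "n - k"] by simp
    finally show ?thesis by (simp add: T_def mult.assoc)
  qed
  have "((\<lambda>p. L p - R p) has_field_derivative 0) (at p)" for p
    using DERIV_diff[OF dL dR, of p] by simp
  hence "L p - R p = L 0 - R 0"
    using DERIV_isconst_all[of "\<lambda>p. L p - R p" p 0] by blast
  moreover have "L 0 = 0" "R 0 = 0"
    using assms by (auto simp: L_def R_def intro!: sum.neutral)
  ultimately have "L p = R p" by simp
  thus ?thesis by (simp only: L_def R_def)
qed

text \<open>The sample space is partitioned by the exact set \<open>S\<close> of indices whose
  variable exceeds \<open>t\<close>. Independence gives each cell a probability that depends only on
  \<open>card S\<close>, and grouping the cells by cardinality produces the binomial
  coefficients.\<close>

lemma (in prob_space) prob_card_ge_eq_binomial_tail: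
  fixes X :: "'i \<Rightarrow> 'a \<Rightarrow> real"
  assumes ind: "indep_vars (\<lambda>_. borel) X I" and fin: "finite I" and ne: "I \<noteq> {}"
    and p: "\<And>i. i \<in> I \<Longrightarrow> prob {\<omega>\<in>space M. t < X i \<omega>} = p"
  shows "prob {\<omega>\<in>space M. k \<le> card {i\<in>I. t < X i \<omega>}} =
    (\<Sum>j=k..card I. real (card I choose j) * p ^ j * (1 - p) ^ (card I - j))"
proof -
  have meas [measurable]: "random_variable borel (X i)" if "i \<in> I" for i
    using ind that by (auto simp: indep_vars_def2)
  define E where "E S = {\<omega>\<in>space M. {i\<in>I. t < X i \<omega>} = S}" for S
  \<comment> \<open>An intersection with one preimage per index is the form to which independence
    applies. Since \<open>I\<close> is nonempty, it stays inside \<open>space M\<close>.\<close>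
  have E_eq: "E S = (\<Inter>i\<in>I. X i -` (if i \<in> S then {t<..} else {..t}) \<inter> space M)"
    if "S \<subseteq> I" for S
    using that ne by (auto simp: E_def not_less split: if_splits)
  have E_sets: "E S \<in> events" if "S \<subseteq> I" for S
    unfolding E_eq[OF that] using fin ne
    by (intro sets.finite_INT measurable_sets[OF meas]) auto
  have prob_E: "prob (E S) = p ^ card S * (1 - p) ^ (card I - card S)" if S: "S \<subseteq> I" for S
  proof -
    have le: "prob (X i -` {..t} \<inter> space M) = 1 - p" if "i \<in> I" for i
    proof -
      have "X i -` {..t} \<inter> space M = space M - {\<omega>\<in>space M. t < X i \<omega>}" by auto
      moreover have "{\<omega>\<in>space M. t < X i \<omega>} \<in> events" using meas[OF that] by measurable
      ultimately show ?thesis by (simp add: prob_compl p[OF that])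
    qed
    have gt: "prob (X i -` {t<..} \<inter> space M) = p" if "i \<in> I" for i
    proof -
      have "X i -` {t<..} \<inter> space M = {\<omega>\<in>space M. t < X i \<omega>}" by auto
      thus ?thesis by (simp add: p[OF that])
    qed
    have "prob (E S) = (\<Prod>i\<in>I. prob (X i -` (if i \<in> S then {t<..} else {..t}) \<inter> space M))"
      unfolding E_eq[OF S] by (rule indep_varsD_finite[OF ind ne fin]) auto
    also have "\<dots> = (\<Prod>i\<in>I. if i \<in> S then p else 1 - p)"
      by (rule prod.cong) (auto simp: le gt)
    also have "\<dots> = p ^ card S * (1 - p) ^ (card I - card S)"
      using S fin by (simp add: prod.If_cases card_Diff_subset finite_subset Int_absorb1
          Diff_eq[symmetric])
    finally show ?thesis .
  qed
  define A where "A = {S. S \<subseteq> I \<and> k \<le> card S}"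
  have finA: "finite A" using fin by (simp add: A_def)
  have "{\<omega>\<in>space M. k \<le> card {i\<in>I. t < X i \<omega>}} = (\<Union>S\<in>A. E S)"
    by (auto simp: A_def E_def)
  moreover have "disjoint_family_on E A"
    by (auto simp: disjoint_family_on_def E_def)
  ultimately have "prob {\<omega>\<in>space M. k \<le> card {i\<in>I. t < X i \<omega>}} = (\<Sum>S\<in>A. prob (E S))"
    using finA E_sets by (simp add: finite_measure_finite_Union A_def image_subset_iff)
  also have "\<dots> = (\<Sum>S\<in>A. p ^ card S * (1 - p) ^ (card I - card S))"
    by (rule sum.cong) (auto simp: A_def prob_E)
  also have "\<dots> = (\<Sum>j=k..card I. \<Sum>S\<in>{S\<in>A. card S = j}. p ^ card S * (1 - p) ^ (card I - card S))"
    by (rule sum.group[symmetric]) (use finA fin in \<open>auto simp: A_def card_mono\<close>)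
  also have "\<dots> = (\<Sum>j=k..card I. real (card I choose j) * p ^ j * (1 - p) ^ (card I - j))"
  proof (rule sum.cong[OF refl])
    fix j assume "j \<in> {k..card I}"
    \<comment> \<open>For \<open>j \<ge> k\<close> the size condition in \<open>A\<close> is
      automatic, so the fibre consists of all subsets of \<open>I\<close> of size
      \<open>j\<close>.\<close>
    hence "{S\<in>A. card S = j} = {S. S \<subseteq> I \<and> card S = j}" by (auto simp: A_def)
    thus "(\<Sum>S\<in>{S\<in>A. card S = j}. p ^ card S * (1 - p) ^ (card I - card S)) =
        real (card I choose j) * p ^ j * (1 - p) ^ (card I - j)"
      using n_subsets[OF fin, of j] by simp
  qed
  finally show ?thesis .
qed

text \<open>In a descending arrangement the positions with value above \<open>t\<close> form an
  initial segment, which reaches position \<open>k\<close> exactly when it has at least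
  \<open>k\<close> elements. The count does not mention \<open>i\<close>, so the way ties are broken
  drops out.\<close>

lemma kth_largest_gt_iff:
  assumes kth: "is_kth_largest M k v i" and k: "1 \<le> k" "k \<le> M"
  shows "t < v i \<longleftrightarrow> k \<le> card {j\<in>{1..M}. t < v j}"
proof -
  obtain \<pi> where bij: "bij_betw \<pi> {1..M} {1..M}"
    and desc: "\<forall>j\<in>{1..M}. \<forall>l\<in>{1..M}. j \<le> l \<longrightarrow> v (\<pi> l) \<le> v (\<pi> j)"
    and i: "\<pi> k = i"
    using kth unfolding is_kth_largest_def by blast
  define J where "J = {j\<in>{1..M}. t < v (\<pi> j)}"
  have "{j\<in>\<pi> ` {1..M}. t < v j} = \<pi> ` J"
    by (auto simp: J_def)
  hence "{j\<in>{1..M}. t < v j} = \<pi> ` J"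
    using bij by (simp only: bij_betw_def)
  moreover have "inj_on \<pi> J"
    using bij by (auto simp: J_def bij_betw_def intro: inj_on_subset)
  ultimately have card: "card {j\<in>{1..M}. t < v j} = card J"
    by (simp add: card_image)
  show ?thesis
  proof
    assume "t < v i"
    have "{1..k} \<subseteq> J"
    proof
      fix j assume j: "j \<in> {1..k}"
      hence "v i \<le> v (\<pi> j)" using desc k i by auto
      thus "j \<in> J" using \<open>t < v i\<close> j k by (simp add: J_def)
    qed
    hence "card {1..k} \<le> card J" by (rule card_mono[rotated]) (simp add: J_def)
    thus "k \<le> card {j\<in>{1..M}. t < v j}" by (simp only: card card_atLeastAtMost diff_Suc_1)
  next
    assume le: "k \<le> card {j\<in>{1..M}. t < v j}"
    show "t < v i"
    proof (rule ccontr)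
      assume not: "\<not> t < v i"
      \<comment> \<open>From position \<open>k\<close> on, all values are at most
        \<open>v i\<close>, hence at most \<open>t\<close>; only the \<open>k - 1\<close> earlier
        positions remain.\<close>
      have "J \<subseteq> {1..<k}"
      proof
        fix j assume j: "j \<in> J"
        have "j < k"
        proof (rule ccontr)
          assume "\<not> j < k"
          hence "v (\<pi> j) \<le> v i" using desc j k i by (auto simp: J_def)
          thus False using j not by (simp add: J_def)
        qed
        thus "j \<in> {1..<k}" using j by (simp add: J_def)
      qed
      hence "card J \<le> k - 1" using card_mono[of "{1..<k}" J] by simp
      thus False using le k unfolding card by simp
    qed
  qed
qed

lemma kth_largest_mem:
  assumes "is_kth_largest M k v i" "1 \<le> k" "k \<le> M"
  shows "i \<in> {1..M}"
  using assms unfolding is_kth_largest_def bij_betw_def by auto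

text \<open>Partial fractions separate the saturation level from a correction that is positive when
  the parameters are and decays as \<open>P\<close> grows. The bound and the limit of the SNR are
  both read off this form.\<close>

lemma harvested_energy_eq:
  assumes "c > 0" "P \<ge> 0"
  shows "harvested_energy a b c t\<^sub>1 P g =
    t\<^sub>1 * (a * c - b) / c - t\<^sub>1 * (a * c - b) / (P * (cmod g)\<^sup>2 + c)"
proof -
  have "P * (cmod g)\<^sup>2 + c > 0" using assms by (simp add: add_nonneg_pos)
  thus ?thesis using assms unfolding harvested_energy_def by (simp add: field_simps)
qed

lemma snr_less_limit:
  assumes "c > 0" "P \<ge> 0" "t\<^sub>1 > 0" "a * c - b > 0" "t\<^sub>2 * noise > 0" "h \<noteq> 0"
  shows "snr a b c t\<^sub>1 t\<^sub>2 noise P g h <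
    (cmod h)\<^sup>2 * (t\<^sub>1 * (a * c - b) / (noise * c * t\<^sub>2))"
proof -
  have "P * (cmod g)\<^sup>2 + c > 0" using assms by (simp add: add_nonneg_pos)
  hence "harvested_energy a b c t\<^sub>1 P g < t\<^sub>1 * (a * c - b) / c"
    using assms by (simp add: harvested_energy_eq)
  hence "snr a b c t\<^sub>1 t\<^sub>2 noise P g h < (cmod h)\<^sup>2 / (t\<^sub>2 * noise) * (t\<^sub>1 * (a * c - b) / c)"
    unfolding snr_def using assms by (intro mult_strict_left_mono) auto
  also have "\<dots> = (cmod h)\<^sup>2 * (t\<^sub>1 * (a * c - b) / (noise * c * t\<^sub>2))"
    by (simp add: mult_ac)
  finally show ?thesis .
qed

lemma snr_tendsto_limit:
  assumes "c > 0" "g \<noteq> 0"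
  shows "((\<lambda>P. snr a b c t\<^sub>1 t\<^sub>2 noise P g h) \<longlongrightarrow>
    (cmod h)\<^sup>2 * (t\<^sub>1 * (a * c - b) / (noise * c * t\<^sub>2))) at_top"
proof -
  have "filterlim (\<lambda>P. P * (cmod g)\<^sup>2) at_top at_top"
    by (rule filterlim_at_top_mult_tendsto_pos[OF tendsto_const _ filterlim_ident]) (use assms in simp)
  hence "filterlim (\<lambda>P. P * (cmod g)\<^sup>2 + c) at_top at_top"
    using filterlim_tendsto_add_at_top[OF tendsto_const[of c]] by (simp add: add.commute)
  hence "((\<lambda>P. t\<^sub>1 * (a * c - b) / (P * (cmod g)\<^sup>2 + c)) \<longlongrightarrow> 0) at_top"
    by (intro real_tendsto_divide_at_top[OF tendsto_const])
  hence "((\<lambda>P. (cmod h)\<^sup>2 / (t\<^sub>2 * noise) *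
      (t\<^sub>1 * (a * c - b) / c - t\<^sub>1 * (a * c - b) / (P * (cmod g)\<^sup>2 + c))) \<longlongrightarrow>
      (cmod h)\<^sup>2 / (t\<^sub>2 * noise) * (t\<^sub>1 * (a * c - b) / c - 0)) at_top"
    by (intro tendsto_intros)
  moreover have "eventually (\<lambda>P. (cmod h)\<^sup>2 / (t\<^sub>2 * noise) *
      (t\<^sub>1 * (a * c - b) / c - t\<^sub>1 * (a * c - b) / (P * (cmod g)\<^sup>2 + c)) =
      snr a b c t\<^sub>1 t\<^sub>2 noise P g h) at_top"
    using eventually_ge_at_top[of 0] by eventually_elim (simp add: snr_def harvested_energy_eq assms)
  ultimately have "((\<lambda>P. snr a b c t\<^sub>1 t\<^sub>2 noise P g h) \<longlongrightarrow>
      (cmod h)\<^sup>2 / (t\<^sub>2 * noise) * (t\<^sub>1 * (a * c - b) / c - 0)) at_top"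
    by (rule Lim_transform_eventually)
  thus ?thesis by (simp add: mult_ac)
qed

text \<open>Convergence alone decides the comparison when the limit differs from \<open>x\<close>.
  If the limit equals \<open>x\<close>, the approach from below keeps the SNR at most
  \<open>x\<close>, so the boundary causes no exception.\<close>

lemma eventually_snr_le_iff:
  assumes "c > 0" "t\<^sub>1 > 0" "a * c - b > 0" "t\<^sub>2 * noise > 0" "x > 0" "g \<noteq> 0"
  shows "eventually (\<lambda>P. snr a b c t\<^sub>1 t\<^sub>2 noise P g h \<le> x \<longleftrightarrow>
    (cmod h)\<^sup>2 * (t\<^sub>1 * (a * c - b) / (noise * c * t\<^sub>2)) \<le> x) at_top"
proof (cases "(cmod h)\<^sup>2 * (t\<^sub>1 * (a * c - b) / (noise * c * t\<^sub>2)) \<le> x")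
  case True
  have "eventually (\<lambda>P. snr a b c t\<^sub>1 t\<^sub>2 noise P g h \<le> x) at_top"
    using eventually_ge_at_top[of 0]
  proof eventually_elim
    case (elim P)
    show ?case
    \<comment> \<open>For \<open>h = 0\<close> the strict bound fails, but the SNR is identically 0,
      which is below \<open>x\<close>.\<close>
    proof (cases "h = 0")
      case True
      thus ?thesis using assms by (simp add: snr_def)
    next
      case False
      thus ?thesis using snr_less_limit[of c P t\<^sub>1 a b t\<^sub>2 noise h g] assms elim True by simp
    qed
  qed
  thus ?thesis using True by simp
next
  case False
  hence "eventually (\<lambda>P. x < snr a b c t\<^sub>1 t\<^sub>2 noise P g h) at_top"
    using order_tendstoD(1)[OF snr_tendsto_limit[OF assms(1,6)]] by simp
  thus ?thesis using False by (auto elim: eventually_mono)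
qed

theorem mainTheorem12:
  fixes \<Omega> :: "'w measure"
    and g h :: "nat \<Rightarrow> 'w \<Rightarrow> complex"
    and sel :: "'w \<Rightarrow> nat"
    and M k :: nat
    and a b c t\<^sub>1 t\<^sub>2 noise x :: real
  assumes "prob_space \<Omega>"
    and "iid_exponential_gains \<Omega> M g h"
    and "ibs_selection \<Omega> M k h sel"
    and "1 \<le> M" and "1 \<le> k" and "k \<le> M"
    and "noise > 0" and "0 < t\<^sub>1" and "t\<^sub>1 < 1" and "t\<^sub>2 = 1 - t\<^sub>1"
    and "c > 0" and "a * c - b > 0" and "x > 0"
  shows "((\<lambda>P\<^sub>t. outage_prob \<Omega> a b c t\<^sub>1 t\<^sub>2 noise g h sel x P\<^sub>t) \<longlongrightarrow>
           1 - real k * real (M choose k) *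
             (\<Sum>m = 0..M - k. (-1) ^ m * real ((M - k) choose m) * (1 / real (k + m)) *
                exp (- (noise * c * t\<^sub>2 * x / (t\<^sub>1 * (a * c - b))) * real (k + m))))
         at_top"
proof -
  interpret prob_space \<Omega> by fact
  define U V where "U i \<omega> = (cmod (g i \<omega>))\<^sup>2" and "V i \<omega> = (cmod (h i \<omega>))\<^sup>2" for i \<omega>
  \<comment> \<open>\<open>\<kappa>\<close> is the limiting SNR per unit of uplink gain, and
    \<open>\<theta>\<close> the uplink gain at which the limiting SNR equals
    \<open>x\<close>.\<close>
  define \<kappa> where "\<kappa> = t\<^sub>1 * (a * c - b) / (noise * c * t\<^sub>2)"
  define \<theta> where "\<theta> = x / \<kappa>"
  have t2: "t\<^sub>2 > 0" using assms by simp
  have \<kappa>: "\<kappa> > 0" using assms t2 by (simp add: \<kappa>_def)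
  have \<theta>: "\<theta> \<ge> 0" and \<theta>_eq: "\<theta> = noise * c * t\<^sub>2 * x / (t\<^sub>1 * (a * c - b))"
    using assms \<kappa> by (simp_all add: \<theta>_def \<kappa>_def)
  have dU: "distributed \<Omega> lborel (U i) (exponential_density 1)"
    and dV: "distributed \<Omega> lborel (V i) (exponential_density 1)" if "i \<in> {1..M}" for i
    using assms(2) that unfolding iid_exponential_gains_def U_def V_def by auto
  have sel_meas [measurable]: "sel \<in> measurable \<Omega> (count_space UNIV)"
    using assms(3) unfolding ibs_selection_def by auto
  have sel_kth: "is_kth_largest M k (\<lambda>i. V i \<omega>) (sel \<omega>)" if "\<omega> \<in> space \<Omega>" for \<omega>
    using assms(3) that unfolding ibs_selection_def V_def by auto
  have sel_in: "sel \<omega> \<in> {1..M}" if "\<omega> \<in> space \<Omega>" for \<omega>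
    using kth_largest_mem[OF sel_kth[OF that]] assms by simp
  have U_meas: "U i \<in> borel_measurable \<Omega>" and V_meas: "V i \<in> borel_measurable \<Omega>" if "i \<in> {1..M}" for i
    using distributed_measurable[OF dU[OF that]] distributed_measurable[OF dV[OF that]] by simp_all

  define A where "A P = {\<omega>\<in>space \<Omega>.
    snr a b c t\<^sub>1 t\<^sub>2 noise P (g (sel \<omega>) \<omega>) (h (sel \<omega>) \<omega>) \<le> x}" for P
  define B where "B = {\<omega>\<in>space \<Omega>. V (sel \<omega>) \<omega> * \<kappa> \<le> x}"
  have A_sets [measurable]: "A P \<in> events" for P
  proof -
    \<comment> \<open>Splitting over the finitely many values of \<open>sel\<close> leaves a fixed
      index. The event is written through \<open>U\<close> and \<open>V\<close> because the
      hypotheses give measurability of the squared moduli, not of \<open>g\<close> and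
      \<open>h\<close>.\<close>
    have "A P = (\<Union>i\<in>{1..M}. {\<omega>\<in>space \<Omega>. sel \<omega> = i \<and> V i \<omega> / (t\<^sub>2 * noise) *
        (t\<^sub>1 * ((a * P * U i \<omega> + b) / (P * U i \<omega> + c) - b / c)) \<le> x})"
      using sel_in by (auto simp: A_def U_def V_def snr_def harvested_energy_def)
    also have "\<dots> \<in> events"
    proof (intro sets.finite_UN)
      fix i assume "i \<in> {1..M}"
      note [measurable] = U_meas[OF this] V_meas[OF this]
      show "{\<omega>\<in>space \<Omega>. sel \<omega> = i \<and> V i \<omega> / (t\<^sub>2 * noise) *
        (t\<^sub>1 * ((a * P * U i \<omega> + b) / (P * U i \<omega> + c) - b / c)) \<le> x} \<in> events" by measurable
    qed simp
    finally show ?thesis .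
  qed
  have B_eq: "B = space \<Omega> - {\<omega>\<in>space \<Omega>. k \<le> card {i\<in>{1..M}. \<theta> < V i \<omega>}}"
  proof -
    have "V (sel \<omega>) \<omega> * \<kappa> \<le> x \<longleftrightarrow> \<not> k \<le> card {i\<in>{1..M}. \<theta> < V i \<omega>}" if "\<omega> \<in> space \<Omega>" for \<omega>
    proof -
      have "V (sel \<omega>) \<omega> * \<kappa> \<le> x \<longleftrightarrow> \<not> \<theta> < V (sel \<omega>) \<omega>"
        using \<kappa> by (auto simp: \<theta>_def field_simps)
      thus ?thesis using kth_largest_gt_iff[OF sel_kth[OF that], of \<theta>] assms by simp
    qed
    thus ?thesis by (auto simp: B_def)
  qed
  have B_sets [measurable]: "B \<in> events"
  proof -
    have "B = (\<Union>i\<in>{1..M}. {\<omega>\<in>space \<Omega>. sel \<omega> = i \<and> V i \<omega> * \<kappa> \<le> x})"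
      using sel_in by (auto simp: B_def)
    also have "\<dots> \<in> events"
    proof (intro sets.finite_UN)
      fix i assume "i \<in> {1..M}"
      note [measurable] = U_meas[OF this] V_meas[OF this]
      show "{\<omega>\<in>space \<Omega>. sel \<omega> = i \<and> V i \<omega> * \<kappa> \<le> x} \<in> events" by measurable
    qed simp
    finally show ?thesis .
  qed

  have U_pos: "AE \<omega> in \<Omega>. 0 < U i \<omega>" if "i \<in> {1..M}" for i
    using AE_prob_1[of "{\<omega>\<in>space \<Omega>. 0 < U i \<omega>}"]
      exponential_distributedD_gt[OF dU[OF that], of 0] by simp
  \<comment> \<open>All devices are covered at once, since the selected index varies with
    \<open>\<omega>\<close>.\<close>
  have AE_pos: "AE \<omega> in \<Omega>. \<forall>i\<in>{1..M}. 0 < U i \<omega>"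
    by (rule AE_finite_allI) (auto intro: U_pos)
  \<comment> \<open>Probabilities become integrals of indicators, dominated by the constant 1.
    Wherever all downlink gains are positive, the indicator of \<open>A P\<close> eventually equals
    that of \<open>B\<close>.\<close>
  have "((\<lambda>P. \<integral>\<omega>. indicator (A P) \<omega> \<partial>\<Omega>) \<longlongrightarrow> (\<integral>\<omega>. indicator B \<omega> \<partial>\<Omega> :: real)) at_top"
  proof (rule integral_dominated_convergence_at_top[where w = "\<lambda>_. 1"])
    show "AE \<omega> in \<Omega>. ((\<lambda>P. indicator (A P) \<omega>) \<longlongrightarrow> (indicator B \<omega> :: real)) at_top"
      using AE_pos AE_space
    proof eventually_elim
      case (elim \<omega>)
      hence "g (sel \<omega>) \<omega> \<noteq> 0" using sel_in[of \<omega>] by (auto simp: U_def)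
      hence "eventually (\<lambda>P. indicator (A P) \<omega> = (indicator B \<omega> :: real)) at_top"
        using eventually_snr_le_iff[of c t\<^sub>1 a b t\<^sub>2 noise x "g (sel \<omega>) \<omega>" "h (sel \<omega>) \<omega>"] assms t2 elim
        by (auto elim!: eventually_mono simp: A_def B_def V_def \<kappa>_def indicator_def)
      thus ?case by (rule tendsto_eventually)
    qed
  qed (auto simp: indicator_def)
  hence "((\<lambda>P. prob (A P)) \<longlongrightarrow> prob B) at_top"
    by simp
  moreover have "prob B = 1 - real k * real (M choose k) *
             (\<Sum>m = 0..M - k. (-1) ^ m * real ((M - k) choose m) * (1 / real (k + m)) *
                exp (- (noise * c * t\<^sub>2 * x / (t\<^sub>1 * (a * c - b))) * real (k + m)))"
  proof -
    let ?C = "{\<omega>\<in>space \<Omega>. k \<le> card {i\<in>{1..M}. \<theta> < V i \<omega>}}"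
    \<comment> \<open>\<open>W\<close> is the joint family of all gains. Restricting it to the
      \<open>Inr\<close> copy of the indices yields independence of the uplink gains without
      reindexing.\<close>
    define W where "W s \<omega> = (case s of Inl i \<Rightarrow> U i \<omega> | Inr i \<Rightarrow> V i \<omega>)" for s \<omega>
    have "?C = space \<Omega> - B" unfolding B_eq by auto
    hence "prob B = 1 - prob ?C" using prob_compl[OF B_sets] by simp
    also have "?C = {\<omega>\<in>space \<Omega>. k \<le> card {s\<in>Inr ` {1..M}. \<theta> < W s \<omega>}}"
    proof -
      have "{s\<in>Inr ` {1..M}. \<theta> < W s \<omega>} = Inr ` {i\<in>{1..M}. \<theta> < V i \<omega>}" for \<omega>
        by (auto simp: W_def)
      thus ?thesis by (simp add: card_image)
    qed
    also have "prob \<dots> = (\<Sum>j=k..card (Inr ` {1..M} :: (nat + nat) set).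
        real (card (Inr ` {1..M} :: (nat + nat) set) choose j) * exp (- \<theta>) ^ j *
        (1 - exp (- \<theta>)) ^ (card (Inr ` {1..M} :: (nat + nat) set) - j))"
    proof (rule prob_card_ge_eq_binomial_tail)
      show "indep_vars (\<lambda>_. borel) W (Inr ` {1..M})"
        using assms(2) unfolding iid_exponential_gains_def W_def U_def V_def
        by (auto elim!: indep_vars_subset)
      show "prob {\<omega>\<in>space \<Omega>. \<theta> < W s \<omega>} = exp (- \<theta>)" if "s \<in> Inr ` {1..M}" for s
        using that exponential_distributedD_gt[OF dV \<theta>] by (auto simp: W_def)
    qed (use assms in auto)
    also have "\<dots> = real k * real (M choose k) *
      (\<Sum>m=0..M - k. (-1) ^ m * real ((M - k) choose m) * (1 / real (k + m)) * exp (- \<theta>) ^ (k + m))"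
      using binomial_tail_eq_alternating_sum[of k M "exp (- \<theta>)"] assms by (simp add: card_image)
    finally show ?thesis
      by (simp only: \<theta>_eq exp_of_nat2_mult)
  qed
  ultimately show ?thesis
    unfolding A_def outage_prob_def by simp
qed

end
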